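(* Let $\mathcal G=(\mathcal V_0,\mathcal E)$ be a finite undirected graph and let $\mathcal V_1,\mathcal V_2\subseteq\mathcal V_0$ be two connected vertex sets with $\mathcal V_1\cap\mathcal V_2=\emptyset$. Write $\mathcal V=\mathcal V_1\cup\mathcal V_2$. Then $$\mathcal H(\mathcal V_1)\mathcal H(\mathcal V_2)\le\mathcal H(\mathcal V)\le\mathcal H(\mathcal V_1)\mathcal H(\mathcal V_2)\times\exp\big[b(\{\mathcal V_1,\mathcal V_2\})\{\log(|\mathcal V_1|)+\log(|\mathcal V_2|)+\log(2)\}\big].$$
   Context: A (nonempty) vertex set $\mathcal V\subseteq\mathcal V_0$ is connected under $\mathcal G$ if any two of its vertices are joined by a path of $\mathcal G$ all of whose vertices lie in $\mathcal V$. $d_{\mathcal G}(\boldsymbol v_1,\boldsymbol v_2)$ is the length (number of edges) of a shortest path between two vertices, and $d_{\mathcal G}(\mathcal V_1,\mathcal V_2)=\min_{\boldsymbol v_1\in\mathcal V_1,\boldsymbol v_2\in\mathcal V_2}d_{\mathcal G}(\boldsymbol v_1,\boldsymbol v_2)$. For connected $\mathcal V$, $\mathcal H(\mathcal V)$ is the number of spanning trees of $\mathcal V$ under $\mathcal G$ (spanning trees of the subgraph induced on $\mathcal V$). A general vertex set decomposes uniquely as $\mathcal V=\cup_j\mathcal V_j$ with each $\mathcal V_j$ connected and $d_{\mathcal G}(\mathcal V_j,\mathcal V_{j'})>1$ for $j\ne j'$, and then $\mathcal H(\mathcal V)=\prod_j\mathcal H(\mathcal V_j)$. $b(\{\mathcal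 V_1,\mathcal V_2\})$ is the number of edges of $\mathcal G$ connecting $\mathcal V_1$ and $\mathcal V_2$. *)

theory Defs
  imports Complex_Main "HOL-Library.Extended_Nat"
begin

record 'a ugraph =
  gverts :: "'a set"
  gedges :: "'a set set"

definition finite_ugraph :: "'a ugraph \<Rightarrow> bool" where
  "finite_ugraph G \<longleftrightarrow>
     finite (gverts G) \<and> (\<forall>e\<in>gedges G. e \<subseteq> gverts G \<and> card e = 2)"

text \<open>A path is the list of its vertices; its length is \<open>length p - 1\<close>.\<close>

definition gpath :: "'a ugraph \<Rightarrow> 'a \<Rightarrow> 'a list \<Rightarrow> 'a \<Rightarrow> bool" where
  "gpath G u p v \<longleftrightarrow>
     p \<noteq> [] \<and> hd p = u \<and> last p = v \<and> distinct p \<and> set p \<subseteq> gverts G \<and>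
     (\<forall>i. Suc i < length p \<longrightarrow> {p ! i, p ! Suc i} \<in> gedges G)"

definition connected_in :: "'a ugraph \<Rightarrow> 'a set \<Rightarrow> bool" where
  "connected_in G W \<longleftrightarrow>
     W \<noteq> {} \<and> W \<subseteq> gverts G \<and>
     (\<forall>u\<in>W. \<forall>v\<in>W. \<exists>p. gpath G u p v \<and> set p \<subseteq> W)"

text \<open>The distance is \<open>\<infinity>\<close> if there is no path.\<close>

definition graph_dist :: "'a ugraph \<Rightarrow> 'a \<Rightarrow> 'a \<Rightarrow> enat" where
  "graph_dist G u v = (INF p\<in>{p. gpath G u p v}. enat (length p - 1))"

definition set_graph_dist :: "'a ugraph \<Rightarrow> 'a set \<Rightarrow> 'a set \<Rightarrow> enat" where
  "set_graph_dist G A B = (INF u\<in>A. INF v\<in>B. graph_dist G u v)"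

definition induced_ugraph :: "'a ugraph \<Rightarrow> 'a set \<Rightarrow> 'a ugraph" where
  "induced_ugraph G W = \<lparr>gverts = W, gedges = {e \<in> gedges G. e \<subseteq> W}\<rparr>"

text \<open>A cycle is the list of its vertices, without repetition of the first one at the end.\<close>

definition gcycle :: "'a ugraph \<Rightarrow> 'a list \<Rightarrow> bool" where
  "gcycle G c \<longleftrightarrow>
     3 \<le> length c \<and> distinct c \<and> set c \<subseteq> gverts G \<and>
     (\<forall>i. Suc i < length c \<longrightarrow> {c ! i, c ! Suc i} \<in> gedges G) \<and>
     {last c, hd c} \<in> gedges G"

definition is_tree :: "'a ugraph \<Rightarrow> bool" where
  "is_tree T \<longleftrightarrow> connected_in T (gverts T) \<and> (\<nexists>c. gcycle T c)"

definition spanning_trees :: "'a ugraph \<Rightarrow> 'a ugraph set" where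
  "spanning_trees G =
     {T. gverts T = gverts G \<and> gedges T \<subseteq> gedges G \<and> is_tree T}"

definition connected_decomp :: "'a ugraph \<Rightarrow> 'a set \<Rightarrow> 'a set set \<Rightarrow> bool" where
  "connected_decomp G W P \<longleftrightarrow>
     \<Union>P = W \<and> (\<forall>A\<in>P. connected_in G A) \<and>
     (\<forall>A\<in>P. \<forall>B\<in>P. A \<noteq> B \<longrightarrow> set_graph_dist G A B > 1)"

text \<open>
  For every vertex set of a finite graph the decomposition in the next definition exists and is
  unique, and for a connected set it is trivial; see \<open>connected_decomp_ex1\<close> and
  \<open>num_span_connected\<close> below.
\<close>

definition num_span :: "'a ugraph \<Rightarrow> 'a set \<Rightarrow> nat" where
  "num_span G W =
     (\<Prod>A\<in>(THE P. connected_decomp G W P). card (spanning_trees (induced_ugraph G A)))"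

definition num_between :: "'a ugraph \<Rightarrow> 'a set \<Rightarrow> 'a set \<Rightarrow> nat" where
  "num_between G A B = card {e \<in> gedges G. \<exists>u\<in>A. \<exists>v\<in>B. e = {u, v}}"


lemma gpath_single: "u \<in> gverts G \<Longrightarrow> gpath G u [u] u"
  by (simp add: gpath_def)

lemma set_graph_dist_edge:
  assumes G: "finite_ugraph G" and "x \<in> A" "y \<in> B" and e: "{x, y} \<in> gedges G"
  shows "set_graph_dist G A B \<le> 1"
proof -
  have xy: "x \<in> gverts G" "y \<in> gverts G" "x \<noteq> y"
    using G e unfolding finite_ugraph_def by (fastforce simp: card_insert_if)+
  have p: "gpath G x [x, y] y"
    using xy e by (auto simp: gpath_def)
  have "set_graph_dist G A B \<le> graph_dist G x y"
    unfolding set_graph_dist_def using assms(2,3) by (meson INF_lower INF_lower2)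
  also have "\<dots> \<le> enat (length [x, y] - 1)"
    unfolding graph_dist_def by (rule INF_lower) (use p in simp)
  finally show ?thesis by (simp add: one_enat_def)
qed

lemma connected_decomp_absorb:
  assumes G: "finite_ugraph G" and Q: "connected_decomp G W Q" and B: "B \<in> Q"
    and C: "connected_in G C" "C \<subseteq> W" "C \<inter> B \<noteq> {}"
  shows "C \<subseteq> B"
proof
  fix v assume v: "v \<in> C"
  obtain u where u: "u \<in> C" "u \<in> B" using C by blast
  obtain p where p: "gpath G u p v" "set p \<subseteq> C"
    using C u v unfolding connected_in_def by blast
  have "p ! i \<in> B" if "i < length p" for i
    using that
  proof (induction i)
    case 0
    then show ?case using p u by (simp add: gpath_def hd_conv_nth)
  next
    case (Suc i)
    have e: "{p ! i, p ! Suc i} \<in> gedges G" using p Suc.prems by (simp add: gpath_def)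
    have "p ! Suc i \<in> W" using p(2) Suc.prems C(2) nth_mem by blast
    then obtain B' where B': "B' \<in> Q" "p ! Suc i \<in> B'"
      using Q unfolding connected_decomp_def by blast
    have "set_graph_dist G B B' \<le> 1"
      using set_graph_dist_edge[OF G _ B'(2) e] Suc by simp
    then show ?case using Q B B' unfolding connected_decomp_def by (metis leD)
  qed
  moreover have "p \<noteq> []" "last p = v" using p(1) by (simp_all add: gpath_def)
  ultimately show "v \<in> B" by (metis last_conv_nth diff_less length_greater_0_conv zero_less_one)
qed

lemma connected_decomp_subset:
  assumes G: "finite_ugraph G" and P: "connected_decomp G W P" and Q: "connected_decomp G W Q"
  shows "P \<subseteq> Q"
proof
  fix A assume A: "A \<in> P"
  have cA: "connected_in G A" "A \<subseteq> W" using A P by (auto simp: connected_decomp_def)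
  then obtain a where a: "a \<in> A" "a \<in> W" by (auto simp: connected_in_def)
  have "\<Union>Q = W" using Q by (simp add: connected_decomp_def)
  with a(2) obtain B where B: "B \<in> Q" "a \<in> B" by blast
  have cB: "connected_in G B" "B \<subseteq> W" using B(1) Q by (auto simp: connected_decomp_def)
  have "A \<inter> B \<noteq> {}" using a(1) B(2) by blast
  then have "A \<subseteq> B" by (rule connected_decomp_absorb[OF G Q B(1) cA])
  moreover have "B \<inter> A \<noteq> {}" using a(1) B(2) by blast
  then have "B \<subseteq> A" by (rule connected_decomp_absorb[OF G P A cB])
  ultimately show "A \<in> Q" using B by simp
qed

lemma gpath_snoc:
  assumes p: "gpath G u p v" "set p \<subseteq> W" and e: "{v, w} \<in> gedges G" "w \<in> W" "w \<in> gverts G"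
  shows "\<exists>q. gpath G u q w \<and> set q \<subseteq> W"
proof (cases "w \<in> set p")
  case True
  then obtain i where i: "i < length p" "p ! i = w" by (metis in_set_conv_nth)
  let ?q = "take (Suc i) p"
  have "last ?q = w" using i by (simp add: take_Suc_conv_app_nth)
  moreover have "hd ?q = u" "?q \<noteq> []" using p(1) i by (auto simp: gpath_def)
  ultimately have "gpath G u ?q w"
    using p(1) i set_take_subset[of "Suc i" p] by (simp add: gpath_def subset_trans)
  moreover have "set ?q \<subseteq> W" using p(2) set_take_subset[of "Suc i" p] by blast
  ultimately show ?thesis by blast
next
  case False
  have "{(p @ [w]) ! i, (p @ [w]) ! Suc i} \<in> gedges G" if "Suc i < length (p @ [w])" for i
  proof (cases "Suc i < length p")
    case True
    then show ?thesis using p(1) by (simp add: gpath_def nth_append)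
  next
    case False
    then have "i = length p - 1" "Suc i = length p" using that by auto
    moreover have "p \<noteq> []" "last p = v" using p(1) by (simp_all add: gpath_def)
    ultimately have "p ! i = v" using last_conv_nth[of p] by simp
    moreover have "i < length p" using \<open>Suc i = length p\<close> by simp
    ultimately show ?thesis using e \<open>Suc i = length p\<close> by (simp add: nth_append)
  qed
  then have "gpath G u (p @ [w]) w"
    using p(1) e False by (simp add: gpath_def)
  then show ?thesis using p(2) e by (intro exI[of _ "p @ [w]"]) simp
qed

lemma connected_decomp_exists:
  assumes W: "W \<subseteq> gverts G"
  shows "\<exists>P. connected_decomp G W P"
proof -
  define R where "R = {(x, y). x \<in> W \<and> y \<in> W \<and> {x, y} \<in> gedges G}"
  define K where "K u = {v. (u, v) \<in> R\<^sup>*}" for u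
  have symR: "sym (R\<^sup>*)"
    by (rule sym_rtrancl) (auto simp: R_def sym_def insert_commute)
  have K_eq: "K x = K u" if "x \<in> K u" for x u
    using that symR unfolding K_def by (auto dest: symD intro: rtrancl_trans)
  have KW: "K u \<subseteq> W" if "u \<in> W" for u
    using that unfolding K_def by (auto elim: rtranclE simp: R_def)
  have path: "\<exists>p. gpath G u p v \<and> set p \<subseteq> K u" if "u \<in> W" "(u, v) \<in> R\<^sup>*" for u v
    using that(2)
  proof induction
    case base
    then show ?case using that W by (intro exI[of _ "[u]"]) (auto intro: gpath_single simp: K_def)
  next
    case (step y z)
    then obtain p where "gpath G u p y" "set p \<subseteq> K u" by blast
    moreover have "z \<in> K u" using step unfolding K_def by (auto intro: rtrancl_into_rtrancl)
    moreover have "{y, z} \<in> gedges G" "z \<in> gverts G" using step W by (auto simp: R_def)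
    ultimately show ?case by (intro gpath_snoc)
  qed
  have refl: "u \<in> K u" for u by (simp add: K_def)
  have conn: "connected_in G (K u)" if u: "u \<in> W" for u
    unfolding connected_in_def
  proof (intro conjI ballI)
    fix x y assume x: "x \<in> K u" and y: "y \<in> K u"
    have Kx: "K x = K u" using K_eq[OF x] .
    have "x \<in> W" using KW[OF u] x by blast
    moreover have "(x, y) \<in> R\<^sup>*" using y unfolding Kx[symmetric] by (simp add: K_def)
    ultimately show "\<exists>p. gpath G x p y \<and> set p \<subseteq> K u"
      using path[of x y] unfolding Kx by blast
  qed (use refl KW u W in blast)+
  have dist: "set_graph_dist G (K u) (K v) > 1" if uv: "u \<in> W" "v \<in> W" "K u \<noteq> K v" for u v
  proof -
    have "2 \<le> enat (length p - 1)" if "x \<in> K u" "y \<in> K v" and p: "gpath G x p y" for x y p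
    proof -
      have ne: "K x \<noteq> K y" and xyW: "x \<in> W" "y \<in> W" using that uv K_eq KW by auto
      have "length p \<noteq> 0" using p by (simp add: gpath_def)
      moreover have "length p \<noteq> 1" using p ne by (auto simp: gpath_def length_Suc_conv)
      moreover have "length p \<noteq> 2"
      proof
        assume "length p = 2"
        then obtain s t where "p = [s, t]" by (metis length_0_conv length_Suc_conv numeral_2_eq_2)
        then have "{x, y} \<in> gedges G" using p by (auto simp: gpath_def)
        then have "y \<in> K x" using xyW by (auto simp: K_def R_def)
        then show False using K_eq ne by metis
      qed
      ultimately have "2 \<le> length p - 1" by linarith
      then show ?thesis by (simp add: numeral_eq_enat)
    qed
    then have "2 \<le> set_graph_dist G (K u) (K v)"
      unfolding set_graph_dist_def graph_dist_def by (intro INF_greatest) auto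
    moreover have "(1::enat) < 2" by simp
    ultimately show ?thesis by (rule less_le_trans[rotated])
  qed
  have "connected_decomp G W (K ` W)"
    unfolding connected_decomp_def using refl KW conn dist by blast
  then show ?thesis ..
qed

lemma connected_decomp_ex1:
  assumes "finite_ugraph G" "W \<subseteq> gverts G"
  shows "\<exists>!P. connected_decomp G W P"
  using connected_decomp_exists[OF assms(2)] connected_decomp_subset[OF assms(1)]
  by (meson subset_antisym)

lemma num_span_decomp:
  assumes "finite_ugraph G" "W \<subseteq> gverts G" "connected_decomp G W P"
  shows "num_span G W = (\<Prod>A\<in>P. card (spanning_trees (induced_ugraph G A)))"
  unfolding num_span_def
  using the1_equality[OF connected_decomp_ex1[OF assms(1,2)] assms(3)] by simp

lemma num_span_connected:
  assumes "finite_ugraph G" "connected_in G W"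
  shows "num_span G W = card (spanning_trees (induced_ugraph G W))"
proof -
  have "connected_decomp G W {W}" using assms(2) by (simp add: connected_decomp_def)
  then show ?thesis using num_span_decomp[OF assms(1)] assms(2) by (simp add: connected_in_def)
qed

end

theory Submission
  imports Defs
begin

text \<open>
  If no edge joins \<open>V1\<close> and \<open>V2\<close>, the two sets are the components of \<open>V\<close> and equality holds.
  If exactly one edge joins them, it lies in every spanning tree of \<open>V\<close>, and deleting it splits
  the tree into a pair of spanning trees; this settles \<open>b = 1\<close> and gives the lower bound for
  every \<open>b > 0\<close>. Each further crossing edge \<open>e\<close> multiplies the count by at most \<open>|V|\<close>:
  a spanning tree through \<open>e\<close> is obtained from one avoiding \<open>e\<close> by exchanging one of its
  \<open>|V| - 1\<close> edges for \<open>e\<close>. Hence \<open>H(V) \<le> H(V1) H(V2) |V|^(b - 1)\<close>, and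
  \<open>|V1| + |V2| \<le> 2 |V1| |V2|\<close>.
\<close>

section \<open>Reachability along plain edge sets\<close>

definition reach :: "'a set set \<Rightarrow> ('a \<times> 'a) set" where
  "reach F = {(x, y). {x, y} \<in> F}\<^sup>*"

definition conn_edges :: "'a set \<Rightarrow> 'a set set \<Rightarrow> bool" where
  "conn_edges W F \<longleftrightarrow> (\<forall>x\<in>W. \<forall>y\<in>W. (x, y) \<in> reach F)"

text \<open>For two-element edges this is acyclicity, in the form that every edge is a bridge.
  Phrased through \<open>reach\<close>, it keeps lists of cycle vertices out of the counting;
  \<open>acyclic_iff_indep_edges\<close> links it to \<open>gcycle\<close>.\<close>

definition indep_edges :: "'a set set \<Rightarrow> bool" where
  "indep_edges F \<longleftrightarrow> (\<forall>x y. {x, y} \<in> F \<longrightarrow> (x, y) \<notin> reach (F - {{x, y}}))"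

text \<open>A spanning tree of a fixed nonempty vertex set is determined by its edges, so edge sets
  are counted instead of graph records; \<open>card_spanning_trees_induced\<close> justifies this
  for induced subgraphs.\<close>

definition tree_edges :: "'a set \<Rightarrow> 'a set set \<Rightarrow> 'a set set set" where
  "tree_edges W E = {F. F \<subseteq> E \<and> conn_edges W F \<and> indep_edges F}"

lemma tree_edgesD:
  assumes "T \<in> tree_edges W E"
  shows "T \<subseteq> E" "conn_edges W T" "indep_edges T"
  using assms by (auto simp: tree_edges_def)

lemma finite_tree_edges: "finite E \<Longrightarrow> finite (tree_edges W E)"
  by (rule finite_subset[of _ "Pow E"]) (auto simp: tree_edges_def)

lemma reach_refl [simp]: "(x, x) \<in> reach F"
  by (simp add: reach_def)

lemma reach_edge: "{x, y} \<in> F \<Longrightarrow> (x, y) \<in> reach F"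
  by (auto simp: reach_def)

lemma reach_trans: "(x, y) \<in> reach F \<Longrightarrow> (y, z) \<in> reach F \<Longrightarrow> (x, z) \<in> reach F"
  unfolding reach_def by (rule rtrancl_trans)

lemma reach_sym: "(x, y) \<in> reach F \<Longrightarrow> (y, x) \<in> reach F"
proof -
  have "sym (reach F)"
    unfolding reach_def by (rule sym_rtrancl) (auto simp: sym_def insert_commute)
  then show "(x, y) \<in> reach F \<Longrightarrow> (y, x) \<in> reach F" by (rule symD)
qed

lemma reach_mono: "(x, y) \<in> reach F \<Longrightarrow> F \<subseteq> F' \<Longrightarrow> (x, y) \<in> reach F'"
  using rtrancl_mono[of "{(x, y). {x, y} \<in> F}" "{(x, y). {x, y} \<in> F'}"]
  unfolding reach_def by auto

text \<open>A walk can be shortened until it uses the new edge at most once, in one of its two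
  directions: a crossing in the opposite direction undoes the previous one.\<close>

lemma reach_insert:
  assumes "(a, b) \<in> reach (insert {u, v} F)"
  shows "(a, b) \<in> reach F \<or> (a, u) \<in> reach F \<and> (v, b) \<in> reach F
    \<or> (a, v) \<in> reach F \<and> (u, b) \<in> reach F"
  using assms unfolding reach_def
proof (induction rule: rtrancl_induct)
  case base
  then show ?case by simp
next
  case (step y z)
  from step.hyps(2) consider "{y, z} \<in> F" | "y = u" "z = v" | "y = v" "z = u"
    by (auto simp: doubleton_eq_iff)
  then show ?case
  proof cases
    case 1
    then have "(y, z) \<in> {(x, y). {x, y} \<in> F}" by simp
    then show ?thesis using step.IH by (meson rtrancl.rtrancl_into_rtrancl)
  next
    case 2
    then show ?thesis using step.IH by auto
  next
    case 3
    then show ?thesis using step.IH by auto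
  qed
qed

text \<open>Edges of \<open>F2\<close> avoid \<open>V1\<close> and edges of \<open>F1\<close> do not
  leave it, so a walk that starts in \<open>V1\<close> never gets to use \<open>F2\<close>.\<close>

lemma reach_separated:
  assumes "(a, b) \<in> reach (F1 \<union> F2)" "a \<in> V1" "\<Union>F1 \<subseteq> V1" "\<Union>F2 \<inter> V1 = {}"
  shows "(a, b) \<in> reach F1 \<and> b \<in> V1"
  using assms(1) unfolding reach_def
proof (induction rule: rtrancl_induct)
  case base
  then show ?case using assms(2) by simp
next
  case (step y z)
  then have "{y, z} \<notin> F2" using assms(4) by blast
  then have "{y, z} \<in> F1" using step.hyps(2) by blast
  then show ?case using step.IH assms(3) by (auto intro: rtrancl_into_rtrancl)
qed

section \<open>Connected and independent edge sets\<close>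

lemma conn_edges_mono: "conn_edges W F \<Longrightarrow> F \<subseteq> F' \<Longrightarrow> conn_edges W F'"
  unfolding conn_edges_def by (blast intro: reach_mono)

lemma conn_edges_join:
  assumes "conn_edges V1 F" "conn_edges V2 F" "{u, v} \<in> F" "u \<in> V1" "v \<in> V2"
  shows "conn_edges (V1 \<union> V2) F"
proof -
  have "(x, u) \<in> reach F" if "x \<in> V1 \<union> V2" for x
    using that assms unfolding conn_edges_def
    by (metis UnE insert_commute reach_edge reach_trans)
  then show ?thesis unfolding conn_edges_def by (meson reach_sym reach_trans)
qed

text \<open>A walk from inside \<open>A\<close> to outside \<open>A\<close> has a step that leaves
  \<open>A\<close>. This supplies the replacement edge in the exchange argument.\<close>

lemma conn_edges_boundary:
  assumes "conn_edges W E" "x \<in> A" "x \<in> W" "y \<notin> A" "y \<in> W"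
  obtains u v where "{u, v} \<in> E" "u \<in> A" "v \<notin> A"
proof -
  have "(x, y) \<in> reach E" using assms by (simp add: conn_edges_def)
  then have "\<exists>u v. {u, v} \<in> E \<and> u \<in> A \<and> v \<notin> A" using assms(4) unfolding reach_def
  proof (induction rule: rtrancl_induct)
    case base
    then show ?case using assms(2) by simp
  next
    case (step y z)
    then show ?case by blast
  qed
  then show thesis using that by blast
qed

lemma indep_edges_subset:
  assumes "indep_edges F'" "F \<subseteq> F'"
  shows "indep_edges F"
  using assms unfolding indep_edges_def by (meson Diff_mono reach_mono subset_iff subset_refl)

text \<open>A detour around the new edge would join \<open>u\<close> and \<open>v\<close> in
  \<open>F\<close>. A detour around an old edge \<open>{a, b}\<close> must use the new edge; its two
  remaining pieces together with \<open>{a, b}\<close> would again join \<open>u\<close> and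
  \<open>v\<close> in \<open>F\<close>.\<close>

lemma indep_edges_insert:
  assumes F: "indep_edges F" and uv: "(u, v) \<notin> reach F"
  shows "indep_edges (insert {u, v} F)"
  unfolding indep_edges_def
proof (intro allI impI notI)
  fix a b
  assume ab: "{a, b} \<in> insert {u, v} F" "(a, b) \<in> reach (insert {u, v} F - {{a, b}})"
  show False
  proof (cases "{a, b} = {u, v}")
    case True
    then have "(a, b) \<in> reach F" using ab(2) by (elim reach_mono) auto
    then show False using True uv reach_sym by (metis doubleton_eq_iff)
  next
    case False
    then have abF: "{a, b} \<in> F" using ab(1) by simp
    have "(a, b) \<in> reach (insert {u, v} (F - {{a, b}}))"
      using ab(2) False by (metis insert_Diff_if singletonD)
    moreover have "(a, b) \<notin> reach (F - {{a, b}})" using F abF by (simp add: indep_edges_def)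
    ultimately have "(a, u) \<in> reach F \<and> (v, b) \<in> reach F \<or> (a, v) \<in> reach F \<and> (u, b) \<in> reach F"
      using reach_insert reach_mono[of _ _ "F - {{a, b}}" F] by (metis Diff_subset)
    then show False using uv reach_edge[OF abF] by (meson reach_sym reach_trans)
  qed
qed

text \<open>The two edge sets touch disjoint vertex sets, so a detour around an edge of one set
  stays within that set.\<close>

lemma indep_edges_Un:
  assumes "indep_edges F1" "indep_edges F2" "\<Union>F1 \<subseteq> V1" "\<Union>F2 \<subseteq> V2" "V1 \<inter> V2 = {}"
  shows "indep_edges (F1 \<union> F2)"
proof -
  have half: False
    if "indep_edges A" "\<Union>A \<subseteq> X" "\<Union>B \<inter> X = {}"
      "{x, y} \<in> A" "(x, y) \<in> reach (A \<union> B - {{x, y}})" for A B X x y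
  proof -
    have "(x, y) \<in> reach ((A - {{x, y}}) \<union> B)"
      using that(5) by (rule reach_mono) auto
    then have "(x, y) \<in> reach (A - {{x, y}})"
      using reach_separated[of x y "A - {{x, y}}" B X] that by auto
    then show False using that by (simp add: indep_edges_def)
  qed
  show ?thesis
    unfolding indep_edges_def
  proof (intro allI impI notI)
    fix x y assume "{x, y} \<in> F1 \<union> F2" and r: "(x, y) \<in> reach (F1 \<union> F2 - {{x, y}})"
    then consider "{x, y} \<in> F1" | "{x, y} \<in> F2" by blast
    then show False
    proof cases
      case 1
      then show False using half[of F1 V1 F2 x y] r assms by blast
    next
      case 2
      then show False using half[of F2 V2 F1 x y] r assms by (metis Un_commute Int_commute disjoint_iff subset_iff)
    qed
  qed
qed

section \<open>The size of a forest\<close>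

text \<open>Edges are added one at a time: independence means that each joins two different
  components, so the number of components drops whenever the number of edges grows.\<close>

lemma card_indep_edges_components:
  assumes "finite W" "finite F" "\<forall>e\<in>F. e \<subseteq> W \<and> card e = 2" "indep_edges F"
  shows "card F + card ((\<lambda>x. reach F `` {x}) ` W) \<le> card W"
  using assms(2-4)
proof (induction rule: finite_induct)
  case empty
  then show ?case by (simp add: card_image_le assms(1))
next
  case (insert e F)
  obtain u v where e: "e = {u, v}" "u \<noteq> v" using insert.prems(1) by (auto simp: card_2_iff)
  have uvW: "u \<in> W" "v \<in> W" using insert.prems(1) e by auto
  have uv: "(u, v) \<notin> reach F"
    using insert.prems(2) insert.hyps(2) e(1) unfolding indep_edges_def
    by (metis Diff_insert_absorb insertI1)
  let ?K = "\<lambda>x. reach F `` {x}" and ?K' = "\<lambda>x. reach (insert e F) `` {x}"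
  have K'eq: "?K' x = ?K' y" if "(x, y) \<in> reach (insert e F)" for x y
  proof -
    have "(x, z) \<in> reach (insert e F) \<longleftrightarrow> (y, z) \<in> reach (insert e F)" for z
      using that reach_trans reach_sym by metis
    then show ?thesis by blast
  qed
  \<comment> \<open>This gives a map from old classes to the new classes containing them that does
    not depend on representatives.\<close>
  have K'Union: "?K' x = \<Union>(?K' ` ?K x)" for x
  proof -
    have "?K' y = ?K' x" if "y \<in> ?K x" for y
      using that K'eq[of x y] reach_mono[of x y F "insert e F"] by auto
    moreover have "x \<in> ?K x" by simp
    ultimately show ?thesis by blast
  qed
  have Kneq: "?K v \<noteq> ?K u"
  proof
    assume "?K v = ?K u"
    moreover have "v \<in> ?K v" by simp
    ultimately show False using uv by blast
  qed
  have "?K' ` W \<subseteq> (\<lambda>S. \<Union>(?K' ` S)) ` (?K ` W - {?K u})"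
  proof
    fix S assume "S \<in> ?K' ` W"
    then obtain w where w: "w \<in> W" "S = ?K' w" by blast
    \<comment> \<open>If \<open>w\<close> lies in the old class of \<open>u\<close>, then
      \<open>v\<close> represents the same new class. The old classes other than that of
      \<open>u\<close> therefore already yield every new class.\<close>
    obtain w' where "w' \<in> W" "?K' w = ?K' w'" "?K w' \<noteq> ?K u"
    proof (cases "?K w = ?K u")
      case True
      have "w \<in> ?K w" by simp
      then have "(u, w) \<in> reach F" using True by blast
      then have "(w, v) \<in> reach (insert e F)"
        using reach_edge[of u v "insert e F"] e(1)
        by (meson insertI1 reach_mono reach_sym reach_trans subset_insertI)
      then show ?thesis using that[of v] uvW Kneq K'eq by blast
    next
      case False
      then show ?thesis using that w by blast
    qed
    then show "S \<in> (\<lambda>S. \<Union>(?K' ` S)) ` (?K ` W - {?K u})"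
      using w K'Union[of w'] by blast
  qed
  then have "card (?K' ` W) \<le> card (?K ` W - {?K u})"
    using assms(1) by (meson surj_card_le finite_Diff finite_imageI)
  also have "\<dots> < card (?K ` W)"
    using assms(1) uvW by (intro card_Diff1_less) auto
  finally have "card (?K' ` W) < card (?K ` W)" .
  moreover have "card F + card (?K ` W) \<le> card W"
    using insert.IH insert.prems indep_edges_subset by blast
  ultimately show ?case using insert.hyps by simp
qed

lemma card_indep_edges_less:
  assumes "finite W" "W \<noteq> {}" "\<forall>e\<in>F. e \<subseteq> W \<and> card e = 2" "indep_edges F"
  shows "card F < card W"
proof -
  have "finite F" using assms(1,3) by (intro finite_subset[of F "Pow W"]) auto
  then have "card F + card ((\<lambda>x. reach F `` {x}) ` W) \<le> card W"
    by (rule card_indep_edges_components[OF assms(1) _ assms(3,4)])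
  moreover have "card ((\<lambda>x. reach F `` {x}) ` W) > 0"
    using assms by (simp add: card_gt_0_iff)
  ultimately show ?thesis by linarith
qed

section \<open>Edge exchange and the cost of one additional edge\<close>

text \<open>Removing \<open>{x, y}\<close> splits the tree into the side of \<open>x\<close> and the
  side of \<open>y\<close>. As \<open>E\<close> connects \<open>W\<close>, some edge of
  \<open>E\<close> joins the two sides and restores a tree. That the new edge lies outside the
  remainder lets the exchange be reversed.\<close>

lemma tree_edges_swap:
  assumes T: "T \<in> tree_edges W (insert {x, y} E)" "{x, y} \<in> T"
    and xy: "x \<in> W" "y \<in> W" and E: "conn_edges W E" and EW: "\<Union>E \<subseteq> W"
  obtains f where "f \<notin> T - {{x, y}}" "insert f (T - {{x, y}}) \<in> tree_edges W E"
proof -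
  let ?T = "T - {{x, y}}"
  have sub: "?T \<subseteq> E" using tree_edgesD(1)[OF T(1)] by auto
  have xyT: "(x, y) \<notin> reach ?T" using tree_edgesD(3)[OF T(1)] T(2) by (simp add: indep_edges_def)
  \<comment> \<open>The set to be left is the component of \<open>x\<close> after the removal; it
    misses \<open>y\<close> by independence of \<open>T\<close>.\<close>
  obtain u v where uv: "{u, v} \<in> E" "(x, u) \<in> reach ?T" "(x, v) \<notin> reach ?T"
    by (rule conn_edges_boundary[OF E, of x "reach ?T `` {x}" y]) (use xy xyT in simp_all)
  have split: "(x, w) \<in> reach ?T \<or> (y, w) \<in> reach ?T" if "w \<in> W" for w
  proof -
    have "(x, w) \<in> reach (insert {x, y} ?T)"
      using tree_edgesD(2)[OF T(1)] T(2) that xy by (simp add: conn_edges_def insert_absorb)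
    then show ?thesis using reach_insert[of x w x y ?T] by blast
  qed
  have v: "(y, v) \<in> reach ?T" using split[of v] uv EW by blast
  let ?T' = "insert {u, v} ?T"
  have mono: "(a, b) \<in> reach ?T'" if "(a, b) \<in> reach ?T" for a b
    using that by (rule reach_mono) auto
  have "(x, y) \<in> reach ?T'"
    by (rule reach_trans[OF reach_trans[OF mono[OF uv(2)] reach_edge] mono[OF reach_sym[OF v]]]) simp
  then have "(x, w) \<in> reach ?T'" if "w \<in> W" for w
    using split[OF that] mono[of x w] mono[of y w] reach_trans[of x y ?T' w] by blast
  then have "conn_edges W ?T'"
    unfolding conn_edges_def by (meson reach_sym reach_trans)
  moreover have nuv: "(u, v) \<notin> reach ?T" using uv(2,3) reach_trans[of x u ?T v] by blast
  then have "indep_edges ?T'"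
    by (intro indep_edges_insert indep_edges_subset[OF tree_edgesD(3)[OF T(1)]]) auto
  moreover have "{u, v} \<notin> ?T" using nuv reach_edge[of u v ?T] by blast
  ultimately show thesis using that[of "{u, v}"] sub uv(1) by (simp add: tree_edges_def)
qed

lemma card_tree_edges_insert:
  assumes W: "finite W" "W \<noteq> {}" and E: "conn_edges W E" "\<forall>e\<in>E. e \<subseteq> W \<and> card e = 2"
    and xy: "x \<in> W" "y \<in> W"
  shows "card (tree_edges W (insert {x, y} E)) \<le> card W * card (tree_edges W E)"
proof -
  let ?e = "{x, y}"
  have finE: "finite E" using W(1) E(2) by (intro finite_subset[of E "Pow W"]) auto
  have finST: "finite (tree_edges W E)" using finE by (rule finite_tree_edges)
  have fin: "finite T" if "T \<in> tree_edges W E" for T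
    by (rule finite_subset[OF tree_edgesD(1)[OF that] finE])
  let ?P = "SIGMA T:tree_edges W E. T"
  let ?g = "\<lambda>(T, f). insert ?e (T - {f})"
  \<comment> \<open>The image of \<open>?g\<close> is the exchange read backwards: an edge
    \<open>f\<close> of a tree within \<open>E\<close> is deleted and \<open>{x, y}\<close> takes
    its place.\<close>
  have "tree_edges W (insert ?e E) \<subseteq> tree_edges W E \<union> ?g ` ?P"
  proof
    fix T assume T: "T \<in> tree_edges W (insert ?e E)"
    show "T \<in> tree_edges W E \<union> ?g ` ?P"
    proof (cases "?e \<in> T")
      case True
      have "\<Union>E \<subseteq> W" using E(2) by blast
      then obtain f where f: "f \<notin> T - {?e}" "insert f (T - {?e}) \<in> tree_edges W E"
        using tree_edges_swap[OF T True xy E(1)] by blast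
      have "(insert f (T - {?e}), f) \<in> ?P" using f by simp
      moreover have "T = ?g (insert f (T - {?e}), f)" using f(1) True by auto
      ultimately show ?thesis by (intro UnI2 rev_image_eqI)
    next
      case False
      then show ?thesis using T by (auto simp: tree_edges_def)
    qed
  qed
  moreover have "finite ?P" using finST fin by (intro finite_SigmaI) auto
  ultimately have "card (tree_edges W (insert ?e E)) \<le> card (tree_edges W E \<union> ?g ` ?P)"
    using finST by (intro card_mono) auto
  also have "\<dots> \<le> card (tree_edges W E) + card (?g ` ?P)" by (rule card_Un_le)
  also have "card (?g ` ?P) \<le> card ?P" using \<open>finite ?P\<close> by (rule card_image_le)
  also have "card ?P = (\<Sum>T\<in>tree_edges W E. card T)"
    using finST fin by (intro card_SigmaI) auto
  also have "\<dots> \<le> (\<Sum>T\<in>tree_edges W E. card W - 1)"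
  proof (rule sum_mono)
    fix T assume T: "T \<in> tree_edges W E"
    have "card T < card W"
      using tree_edgesD[OF T] E(2) by (intro card_indep_edges_less[OF W]) auto
    then show "card T \<le> card W - 1" by simp
  qed
  \<comment> \<open>Each tree within \<open>E\<close> accounts for itself and for at most
    \<open>card W - 1\<close> exchanges; \<open>W\<close> is nonempty, so the subtraction is not
    truncated.\<close>
  also have "card (tree_edges W E) + \<dots> = card W * card (tree_edges W E)"
    using W by (cases "card W") auto
  finally show ?thesis by simp
qed

section \<open>Splitting and joining trees at a crossing edge\<close>

lemma tree_edges_bridge:
  assumes E: "\<Union>E1 \<subseteq> V1" "\<Union>E2 \<subseteq> V2" "V1 \<inter> V2 = {}" and uv: "u \<in> V1" "v \<in> V2"
    and T: "T \<in> tree_edges (V1 \<union> V2) (insert {u, v} (E1 \<union> E2))"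
  shows "{u, v} \<in> T" "T \<inter> E1 \<in> tree_edges V1 E1" "T \<inter> E2 \<in> tree_edges V2 E2"
proof -
  note T' = tree_edgesD[OF T]
  have sep: "(a, b) \<in> reach (T \<inter> E1) \<and> b \<in> V1"
    if "(a, b) \<in> reach (T \<inter> E1 \<union> T \<inter> E2)" "a \<in> V1" for a b
    using reach_separated[OF that] E by blast
  have sep': "(a, b) \<in> reach (T \<inter> E2) \<and> b \<in> V2"
    if "(a, b) \<in> reach (T \<inter> E1 \<union> T \<inter> E2)" "a \<in> V2" for a b
  proof -
    have "(a, b) \<in> reach (T \<inter> E2 \<union> T \<inter> E1)" using that(1) by (simp add: Un_commute)
    then show ?thesis using reach_separated[of a b "T \<inter> E2" "T \<inter> E1" V2] that(2) E by blast
  qed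
  have reach: "(a, b) \<in> reach (insert {u, v} (T \<inter> E1 \<union> T \<inter> E2))"
    if "a \<in> V1 \<union> V2" "b \<in> V1 \<union> V2" for a b
  proof -
    have "(a, b) \<in> reach T" using T'(2) that by (simp add: conn_edges_def)
    then show ?thesis using T'(1) by (elim reach_mono) auto
  qed
  show "{u, v} \<in> T"
  proof (rule ccontr)
    assume "{u, v} \<notin> T"
    then have "T \<subseteq> T \<inter> E1 \<union> T \<inter> E2" using T'(1) by auto
    moreover have "(u, v) \<in> reach T" using T'(2) uv by (simp add: conn_edges_def)
    ultimately have "(u, v) \<in> reach (T \<inter> E1 \<union> T \<inter> E2)" by (metis reach_mono)
    then show False using sep[of u v] uv E(3) by blast
  qed
  have "conn_edges V1 (T \<inter> E1)"
    unfolding conn_edges_def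
  proof (intro ballI)
    fix a b assume ab: "a \<in> V1" "b \<in> V1"
    \<comment> \<open>Each alternative of \<open>reach_insert\<close> that uses the bridge contains
      one of these two walks, which would have to change sides without the bridge.\<close>
    have "\<not> (a, v) \<in> reach (T \<inter> E1 \<union> T \<inter> E2)" "\<not> (v, b) \<in> reach (T \<inter> E1 \<union> T \<inter> E2)"
      using sep[of a v] sep'[of v b] ab uv E(3) by blast+
    then show "(a, b) \<in> reach (T \<inter> E1)"
      using reach_insert[OF reach[of a b]] ab sep by blast
  qed
  then show "T \<inter> E1 \<in> tree_edges V1 E1"
    using indep_edges_subset[OF T'(3), of "T \<inter> E1"] by (simp add: tree_edges_def)
  have "conn_edges V2 (T \<inter> E2)"
    unfolding conn_edges_def
  proof (intro ballI)
    fix a b assume ab: "a \<in> V2" "b \<in> V2"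
    have "\<not> (a, u) \<in> reach (T \<inter> E1 \<union> T \<inter> E2)" "\<not> (u, b) \<in> reach (T \<inter> E1 \<union> T \<inter> E2)"
      using sep'[of a u] sep[of u b] ab uv E(3) by blast+
    then show "(a, b) \<in> reach (T \<inter> E2)"
      using reach_insert[OF reach[of a b]] ab sep' by blast
  qed
  then show "T \<inter> E2 \<in> tree_edges V2 E2"
    using indep_edges_subset[OF T'(3), of "T \<inter> E2"] by (simp add: tree_edges_def)
qed

text \<open>Splitting is injective: every tree contains the bridge, so its two restrictions
  determine it.\<close>

lemma card_tree_edges_bridge_le:
  assumes fin: "finite E1" "finite E2"
    and E: "\<Union>E1 \<subseteq> V1" "\<Union>E2 \<subseteq> V2" "V1 \<inter> V2 = {}" and uv: "u \<in> V1" "v \<in> V2"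
  shows "card (tree_edges (V1 \<union> V2) (insert {u, v} (E1 \<union> E2)))
    \<le> card (tree_edges V1 E1) * card (tree_edges V2 E2)"
proof -
  let ?S = "tree_edges (V1 \<union> V2) (insert {u, v} (E1 \<union> E2))"
  let ?f = "\<lambda>T. (T \<inter> E1, T \<inter> E2)"
  note bridge = tree_edges_bridge[OF E uv]
  have "inj_on ?f ?S"
  proof (rule inj_on_inverseI[where g = "\<lambda>(A, B). insert {u, v} (A \<union> B)"])
    fix T assume "T \<in> ?S"
    then show "(\<lambda>(A, B). insert {u, v} (A \<union> B)) (T \<inter> E1, T \<inter> E2) = T"
      using bridge(1)[of T] tree_edgesD(1)[of T] by fastforce
  qed
  moreover have "?f ` ?S \<subseteq> tree_edges V1 E1 \<times> tree_edges V2 E2" using bridge by blast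
  ultimately have "card ?S \<le> card (tree_edges V1 E1 \<times> tree_edges V2 E2)"
    using fin by (meson card_inj_on_le finite_SigmaI finite_tree_edges)
  then show ?thesis by (simp add: card_cartesian_product)
qed

text \<open>Two trees joined by the fixed edge \<open>{u, v}\<close> form a tree of the union.
  \<open>E\<close> may contain further crossing edges, which these joined trees leave out.\<close>

lemma card_tree_edges_join_ge:
  assumes fin: "finite E" and sub: "insert {u, v} (E1 \<union> E2) \<subseteq> E"
    and E: "\<Union>E1 \<subseteq> V1" "\<Union>E2 \<subseteq> V2" "V1 \<inter> V2 = {}" "{} \<notin> E1" "{} \<notin> E2"
    and uv: "u \<in> V1" "v \<in> V2"
  shows "card (tree_edges V1 E1) * card (tree_edges V2 E2) \<le> card (tree_edges (V1 \<union> V2) E)"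
proof -
  let ?P = "tree_edges V1 E1 \<times> tree_edges V2 E2"
  let ?g = "\<lambda>(A, B). insert {u, v} (A \<union> B)"
  \<comment> \<open>Intersecting with \<open>E1\<close> and \<open>E2\<close> recovers the two trees
    only if these sets are disjoint. The empty set is the one set inside both \<open>V1\<close> and
    \<open>V2\<close>, and the hypotheses on \<open>{}\<close> exclude it.\<close>
  have disj: "E1 \<inter> E2 = {}" "{u, v} \<notin> E1" "{u, v} \<notin> E2"
  proof -
    have "e = {}" if "e \<in> E1" "e \<in> E2" for e using that E(1-3) by blast
    then show "E1 \<inter> E2 = {}" using E(4) by blast
  qed (use E(1-3) uv in blast)+
  have "inj_on ?g ?P"
  proof (rule inj_on_inverseI[where g = "\<lambda>T. (T \<inter> E1, T \<inter> E2)"])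
    fix p assume "p \<in> ?P"
    then obtain A B where "p = (A, B)" "A \<subseteq> E1" "B \<subseteq> E2" by (auto dest: tree_edgesD(1))
    then show "(\<lambda>T. (T \<inter> E1, T \<inter> E2)) (?g p) = p" using disj by auto
  qed
  moreover have "?g ` ?P \<subseteq> tree_edges (V1 \<union> V2) E"
  proof clarify
    fix A B assume A: "A \<in> tree_edges V1 E1" and B: "B \<in> tree_edges V2 E2"
    note A' = tree_edgesD[OF A] and B' = tree_edgesD[OF B]
    have UA: "\<Union>A \<subseteq> V1" "\<Union>B \<subseteq> V2" using A' B' E by blast+
    have "(u, v) \<notin> reach (A \<union> B)"
      using reach_separated[of u v A B V1] UA E(3) uv by blast
    then have "indep_edges (insert {u, v} (A \<union> B))"
      by (intro indep_edges_insert indep_edges_Un[OF A'(3) B'(3) UA E(3)])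
    moreover have "conn_edges (V1 \<union> V2) (insert {u, v} (A \<union> B))"
      using uv by (intro conn_edges_join conn_edges_mono[OF A'(2)] conn_edges_mono[OF B'(2)]) auto
    ultimately show "insert {u, v} (A \<union> B) \<in> tree_edges (V1 \<union> V2) E"
      using A'(1) B'(1) sub by (auto simp: tree_edges_def)
  qed
  ultimately have "card ?P \<le> card (tree_edges (V1 \<union> V2) E)"
    using fin by (meson card_inj_on_le finite_tree_edges)
  then show ?thesis by (simp add: card_cartesian_product)
qed

section \<open>The upper bound for several crossing edges\<close>

text \<open>Induction starts from one crossing edge, which costs no factor; hence the exponent
  \<open>card B - 1\<close>. Each later edge costs a factor
  \<open>card (V1 \<union> V2)\<close>.\<close>

lemma card_tree_edges_crossing:
  assumes V: "finite V1" "finite V2" "V1 \<inter> V2 = {}"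
    and E: "\<forall>e\<in>E1. e \<subseteq> V1 \<and> card e = 2" "\<forall>e\<in>E2. e \<subseteq> V2 \<and> card e = 2"
    and conn: "conn_edges V1 E1" "conn_edges V2 E2"
    and B: "finite B" "B \<noteq> {}" "\<forall>e\<in>B. \<exists>u\<in>V1. \<exists>v\<in>V2. e = {u, v}"
  shows "card (tree_edges (V1 \<union> V2) (E1 \<union> E2 \<union> B))
    \<le> card (V1 \<union> V2) ^ (card B - 1) * (card (tree_edges V1 E1) * card (tree_edges V2 E2))"
  using B
proof (induction rule: finite_ne_induct)
  case (singleton e)
  then obtain u v where e: "e = {u, v}" "u \<in> V1" "v \<in> V2" by auto
  have fin: "finite E1" "finite E2"
    by (rule finite_subset[of _ "Pow V1"] finite_subset[of _ "Pow V2"]; use V E in auto)+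
  have "\<Union>E1 \<subseteq> V1" "\<Union>E2 \<subseteq> V2" using E by blast+
  then show ?case using card_tree_edges_bridge_le[OF fin _ _ V(3) e(2,3)] e(1) by simp
next
  case (insert e B)
  then obtain u v where e: "e = {u, v}" "u \<in> V1" "v \<in> V2" by auto
  obtain u' v' where e': "{u', v'} \<in> B" "u' \<in> V1" "v' \<in> V2"
    using insert.hyps(2) insert.prems by (metis all_not_in_conv insertCI)
  let ?E = "E1 \<union> E2 \<union> B" and ?H = "card (tree_edges V1 E1) * card (tree_edges V2 E2)"
  \<comment> \<open>The exchange argument needs the graph without \<open>e\<close> to be connected
    already; an edge of the nonempty \<open>B\<close> ensures this.\<close>
  have "conn_edges (V1 \<union> V2) ?E"
    using conn_edges_mono[OF conn(1), of ?E] conn_edges_mono[OF conn(2), of ?E] e'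
    by (intro conn_edges_join[of _ _ _ u' v']) auto
  moreover have "\<forall>e\<in>B. e \<subseteq> V1 \<union> V2 \<and> card e = 2"
    using insert.prems V(3) by (fastforce simp: card_2_iff)
  then have "\<forall>e\<in>?E. e \<subseteq> V1 \<union> V2 \<and> card e = 2" using E by blast
  ultimately have "card (tree_edges (V1 \<union> V2) (insert e ?E))
      \<le> card (V1 \<union> V2) * card (tree_edges (V1 \<union> V2) ?E)"
    unfolding e(1) using V e by (intro card_tree_edges_insert) auto
  also have "\<dots> \<le> card (V1 \<union> V2) * (card (V1 \<union> V2) ^ (card B - 1) * ?H)"
    using insert.IH insert.prems by (intro mult_left_mono) auto
  also have "\<dots> = card (V1 \<union> V2) ^ card B * ?H"
    using insert.hyps(1,2) by (cases "card B") auto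
  finally show ?case using insert.hyps by simp
qed

section \<open>Translation between edge sets and the paths, cycles and trees of the
  definitions\<close>

lemma reach_path:
  assumes "p \<noteq> []" "\<forall>i. Suc i < length p \<longrightarrow> {p ! i, p ! Suc i} \<in> F"
  shows "(hd p, last p) \<in> reach F"
proof -
  have "(hd p, p ! i) \<in> reach F" if "i < length p" for i
    using that
  proof (induction i)
    case 0
    then show ?case by (simp add: hd_conv_nth)
  next
    case (Suc i)
    then show ?case using assms(2) by (meson Suc_lessD reach_edge reach_trans)
  qed
  then show ?thesis using assms(1) by (simp add: last_conv_nth)
qed

text \<open>A walk may revisit vertices while \<open>gpath\<close> demands distinct ones;
  \<open>gpath_snoc\<close> cuts the path back at each revisited vertex.\<close>

lemma gpath_of_reach:
  assumes "(u, v) \<in> reach F" "F \<subseteq> gedges G" "\<Union>F \<subseteq> W" "W \<subseteq> gverts G" "u \<in> W"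
  shows "\<exists>p. gpath G u p v \<and> set p \<subseteq> W"
  using assms(1) unfolding reach_def
proof (induction rule: rtrancl_induct)
  case base
  then show ?case using assms by (intro exI[of _ "[u]"]) (auto intro: gpath_single)
next
  case (step y z)
  then obtain p where p: "gpath G u p y" "set p \<subseteq> W" by blast
  have "{y, z} \<in> F" using step by simp
  then show ?case using gpath_snoc[OF p, of z] assms by blast
qed

lemma connected_in_iff:
  "connected_in G W \<longleftrightarrow>
    W \<noteq> {} \<and> W \<subseteq> gverts G \<and> conn_edges W {e \<in> gedges G. e \<subseteq> W}"
proof -
  let ?F = "{e \<in> gedges G. e \<subseteq> W}"
  have "(\<exists>p. gpath G u p v \<and> set p \<subseteq> W) \<longleftrightarrow> (u, v) \<in> reach ?F"
    if uv: "W \<subseteq> gverts G" "u \<in> W" for u v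
  proof
    assume "\<exists>p. gpath G u p v \<and> set p \<subseteq> W"
    then obtain p where p: "gpath G u p v" "set p \<subseteq> W" by blast
    have "\<forall>i. Suc i < length p \<longrightarrow> {p ! i, p ! Suc i} \<in> ?F"
      using p by (auto simp: gpath_def)
    then show "(u, v) \<in> reach ?F" using reach_path[of p ?F] p(1) by (auto simp: gpath_def)
  next
    assume "(u, v) \<in> reach ?F"
    then show "\<exists>p. gpath G u p v \<and> set p \<subseteq> W"
      using uv by (intro gpath_of_reach[of _ _ ?F]) auto
  qed
  then show ?thesis unfolding connected_in_def conn_edges_def by blast
qed

text \<open>A simple detour around an edge is, as a list, exactly a cycle closed by that edge;
  conversely the rest of a cycle is a detour around its closing edge.\<close>

lemma acyclic_iff_indep_edges:
  assumes T: "\<forall>e\<in>gedges T. e \<subseteq> gverts T \<and> card e = 2"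
  shows "(\<nexists>c. gcycle T c) \<longleftrightarrow> indep_edges (gedges T)"
proof
  assume acyc: "\<nexists>c. gcycle T c"
  show "indep_edges (gedges T)"
    unfolding indep_edges_def
  proof (intro allI impI notI)
    fix x y assume e: "{x, y} \<in> gedges T" and r: "(x, y) \<in> reach (gedges T - {{x, y}})"
    have xy: "x \<noteq> y" "x \<in> gverts T" using T e by (fastforce simp: card_insert_if)+
    \<comment> \<open>Deleting the edge from the graph forces the path to avoid it, so the path has
      at least three vertices, as \<open>gcycle\<close> demands.\<close>
    let ?G = "\<lparr>gverts = gverts T, gedges = gedges T - {{x, y}}\<rparr>"
    obtain p where p: "gpath ?G x p y"
      using gpath_of_reach[OF r, of ?G "gverts T"] T xy by auto
    have "length p \<noteq> 0" "length p \<noteq> 1"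
      using p xy by (auto simp: gpath_def length_Suc_conv)
    moreover have "length p \<noteq> 2"
    proof
      assume "length p = 2"
      then obtain s t where "p = [s, t]" by (metis length_0_conv length_Suc_conv numeral_2_eq_2)
      then show False using p by (auto simp: gpath_def)
    qed
    ultimately have "3 \<le> length p" by linarith
    then have "gcycle T p"
      using p e by (auto simp: gpath_def gcycle_def insert_commute)
    then show False using acyc by blast
  qed
next
  assume ind: "indep_edges (gedges T)"
  show "\<nexists>c. gcycle T c"
  proof
    assume "\<exists>c. gcycle T c"
    then obtain c where c: "3 \<le> length c" "distinct c"
      "\<And>i. Suc i < length c \<Longrightarrow> {c ! i, c ! Suc i} \<in> gedges T" "{last c, hd c} \<in> gedges T"
      by (auto simp: gcycle_def)
    have ne: "c \<noteq> []" using c(1) by auto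
    \<comment> \<open>Two consecutive vertices could be the first and the last only in a list of
      length two.\<close>
    have "{c ! i, c ! Suc i} \<noteq> {hd c, last c}" if i: "Suc i < length c" for i
    proof
      assume "{c ! i, c ! Suc i} = {hd c, last c}"
      then have "{c ! i, c ! Suc i} = {c ! 0, c ! (length c - 1)}"
        using ne by (simp add: hd_conv_nth last_conv_nth)
      then show False
        using i c(1) nth_eq_iff_index_eq[OF c(2), of i 0]
          nth_eq_iff_index_eq[OF c(2), of i "length c - 1"]
          nth_eq_iff_index_eq[OF c(2), of "Suc i" 0]
          nth_eq_iff_index_eq[OF c(2), of "Suc i" "length c - 1"]
        unfolding doubleton_eq_iff by linarith
    qed
    then have "(hd c, last c) \<in> reach (gedges T - {{hd c, last c}})"
      using c(3) ne by (intro reach_path) auto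
    moreover have "{hd c, last c} \<in> gedges T" using c(4) by (simp add: insert_commute)
    ultimately show False using ind by (simp add: indep_edges_def)
  qed
qed

text \<open>Passing to the edge set is a bijection. For empty \<open>W\<close> the counts differ:
  the empty edge set qualifies, but a tree has a vertex.\<close>

lemma card_spanning_trees_induced:
  assumes G: "finite_ugraph G" and W: "W \<noteq> {}"
  shows "card (spanning_trees (induced_ugraph G W))
    = card (tree_edges W {e \<in> gedges G. e \<subseteq> W})"
proof -
  let ?E = "{e \<in> gedges G. e \<subseteq> W}"
  have tree: "is_tree T \<longleftrightarrow> conn_edges W (gedges T) \<and> indep_edges (gedges T)"
    if "gverts T = W" "gedges T \<subseteq> ?E" for T :: "'a ugraph"
  proof -
    have T: "\<forall>e\<in>gedges T. e \<subseteq> gverts T \<and> card e = 2"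
      using that G by (auto simp: finite_ugraph_def)
    then have "{e \<in> gedges T. e \<subseteq> W} = gedges T" using that by blast
    then show ?thesis
      using acyclic_iff_indep_edges[OF T] that W by (auto simp: is_tree_def connected_in_iff)
  qed
  have "bij_betw gedges (spanning_trees (induced_ugraph G W)) (tree_edges W ?E)"
  proof (rule bij_betw_byWitness[where f' = "\<lambda>F. \<lparr>gverts = W, gedges = F\<rparr>"])
    show "gedges ` spanning_trees (induced_ugraph G W) \<subseteq> tree_edges W ?E"
      using tree by (auto simp: spanning_trees_def induced_ugraph_def tree_edges_def)
    show "(\<lambda>F. \<lparr>gverts = W, gedges = F\<rparr>) ` tree_edges W ?E
        \<subseteq> spanning_trees (induced_ugraph G W)"
    proof clarify
      fix F assume F: "F \<in> tree_edges W ?E"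
      then show "\<lparr>gverts = W, gedges = F\<rparr> \<in> spanning_trees (induced_ugraph G W)"
        using tree[of "\<lparr>gverts = W, gedges = F\<rparr>"]
        by (simp add: spanning_trees_def induced_ugraph_def tree_edges_def)
    qed
  qed (auto simp: spanning_trees_def induced_ugraph_def)
  then show ?thesis by (rule bij_betw_same_card)
qed

section \<open>Vertex sets without crossing edges\<close>

lemma set_graph_dist_gt_1:
  assumes "A \<inter> B = {}" "\<And>x y. x \<in> A \<Longrightarrow> y \<in> B \<Longrightarrow> {x, y} \<notin> gedges G"
  shows "set_graph_dist G A B > 1"
proof -
  \<comment> \<open>A path with one vertex contradicts disjointness, and one with two vertices is a
    crossing edge. The bound 2 is non-strict, so it passes to the infimum.\<close>
  have "2 \<le> enat (length p - 1)" if xy: "x \<in> A" "y \<in> B" and p: "gpath G x p y" for x y p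
  proof -
    have "length p \<noteq> 0" "length p \<noteq> 1"
      using p xy assms(1) by (auto simp: gpath_def length_Suc_conv)
    moreover have "length p \<noteq> 2"
    proof
      assume "length p = 2"
      then obtain s t where "p = [s, t]" by (metis length_0_conv length_Suc_conv numeral_2_eq_2)
      then show False using p assms(2)[OF xy] by (auto simp: gpath_def)
    qed
    ultimately have "2 \<le> length p - 1" by linarith
    then show ?thesis by (simp add: numeral_eq_enat)
  qed
  then have "2 \<le> set_graph_dist G A B"
    unfolding set_graph_dist_def graph_dist_def by (intro INF_greatest) auto
  moreover have "(1::enat) < 2" by simp
  ultimately show ?thesis by (rule less_le_trans[rotated])
qed

lemma num_span_separated:
  assumes G: "finite_ugraph G" and V: "connected_in G V1" "connected_in G V2" "V1 \<inter> V2 = {}"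
    and sep: "\<And>x y. x \<in> V1 \<Longrightarrow> y \<in> V2 \<Longrightarrow> {x, y} \<notin> gedges G"
  shows "num_span G (V1 \<union> V2) = num_span G V1 * num_span G V2"
proof -
  have "set_graph_dist G V1 V2 > 1" "set_graph_dist G V2 V1 > 1"
    using V(3) sep
    by (intro set_graph_dist_gt_1; force simp: insert_commute)+
  then have "connected_decomp G (V1 \<union> V2) {V1, V2}"
    using V by (auto simp: connected_decomp_def)
  \<comment> \<open>The product in \<open>num_span\<close> runs over a set of components, so
    \<open>V1\<close> and \<open>V2\<close> give two factors only when they differ.\<close>
  moreover have "V1 \<noteq> V2" "V1 \<union> V2 \<subseteq> gverts G" using V by (auto simp: connected_in_def)
  ultimately show ?thesis
    using num_span_decomp[OF G] num_span_connected[OF G V(1)] num_span_connected[OF G V(2)] by simp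
qed

section \<open>The exponential bound and the conclusion\<close>

text \<open>The right-hand side equals \<open>(2 * m * n) ^ b\<close>, and
  \<open>m + n \<le> 2 * m * n\<close> because both numbers are at least 1. One surplus factor
  \<open>m + n\<close> is given away.\<close>

lemma add_power_le_exp:
  assumes "m > 0" "n > 0" "b > 0"
  shows "real ((m + n) ^ (b - 1)) \<le> exp (real b * (ln (real m) + ln (real n) + ln 2))"
proof -
  have "(m + n) ^ (b - 1) \<le> (m + n) ^ b"
    using assms by (intro power_increasing) auto
  also have "m + n \<le> 2 * m * n"
  proof -
    have "m \<le> m * n" "n \<le> m * n" using assms by simp_all
    then show ?thesis by linarith
  qed
  then have "(m + n) ^ b \<le> (2 * m * n) ^ b" by (rule power_mono) simp
  finally have "real ((m + n) ^ (b - 1)) \<le> real ((2 * m * n) ^ b)" by (rule of_nat_mono)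
  also have "\<dots> = exp (ln (2 * real m * real n)) ^ b" using assms by simp
  also have "ln (2 * real m * real n) = ln (real m) + ln (real n) + ln 2"
    using assms by (simp add: ln_mult)
  finally show ?thesis by (simp add: exp_of_nat_mult)
qed

theorem lemmaS22:
  fixes G :: "'a ugraph" and V1 V2 V :: "'a set"
  assumes "finite_ugraph G"
    and "V1 \<subseteq> gverts G" and "V2 \<subseteq> gverts G"
    and "connected_in G V1" and "connected_in G V2"
    and "V1 \<inter> V2 = {}"
    and "V = V1 \<union> V2"
  shows "num_span G V1 * num_span G V2 \<le> num_span G V \<and>
    real (num_span G V) \<le>
      real (num_span G V1) * real (num_span G V2) *
        exp (real (num_between G V1 V2) * (ln (real (card V1)) + ln (real (card V2)) + ln 2))"
proof -
  note G = assms(1) and c1 = assms(4) and c2 = assms(5) and disj = assms(6)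
  let ?E = "\<lambda>W. {e \<in> gedges G. e \<subseteq> W}"
  let ?B = "{e \<in> gedges G. \<exists>u\<in>V1. \<exists>v\<in>V2. e = {u, v}}"
  have E2: "e \<subseteq> gverts G \<and> card e = 2" if "e \<in> gedges G" for e
    using that G by (simp add: finite_ugraph_def)
  have finV: "finite (gverts G)" using G by (simp add: finite_ugraph_def)
  have finE: "finite (gedges G)" by (rule finite_subset[of _ "Pow (gverts G)"]) (use E2 finV in auto)
  have fin: "finite V1" "finite V2" using assms(2,3) finV finite_subset by blast+
  have ne: "V1 \<noteq> {}" "V2 \<noteq> {}" and conn: "conn_edges V1 (?E V1)" "conn_edges V2 (?E V2)"
    using c1 c2 by (auto simp: connected_in_iff)
  show ?thesis
  proof (cases "?B = {}")
    \<comment> \<open>The exponent is zero here, so both bounds reduce to the product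
      formula.\<close>
    case True
    then have "num_span G V = num_span G V1 * num_span G V2"
      unfolding assms(7) by (intro num_span_separated[OF G c1 c2 disj]) blast
    moreover have "num_between G V1 V2 = 0" unfolding num_between_def True by simp
    ultimately show ?thesis by simp
  next
    case False
    then obtain u v where uv: "{u, v} \<in> gedges G" "u \<in> V1" "v \<in> V2" by blast
    \<comment> \<open>A two-element edge inside the union lies in one part or has an end in
      each.\<close>
    have EV: "?E V = ?E V1 \<union> ?E V2 \<union> ?B"
    proof
      show "?E V \<subseteq> ?E V1 \<union> ?E V2 \<union> ?B"
      proof
        fix e assume e: "e \<in> ?E V"
        then obtain a b where "e = {a, b}" using E2[of e] by (auto simp: card_2_iff)
        then show "e \<in> ?E V1 \<union> ?E V2 \<union> ?B" using e assms(7) by (auto simp: insert_commute)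
      qed
      show "?E V1 \<union> ?E V2 \<union> ?B \<subseteq> ?E V" unfolding assms(7) by blast
    qed
    \<comment> \<open>One crossing edge makes \<open>V\<close> connected, so
      \<open>num_span G V\<close> counts the trees of a single component.\<close>
    have "conn_edges V (?E V)"
      unfolding assms(7) using uv conn
      by (intro conn_edges_join[of _ _ _ u v]) (auto elim: conn_edges_mono)
    then have cV: "connected_in G V"
      using ne assms(2,3,7) by (auto simp: connected_in_iff)
    have span: "num_span G W = card (tree_edges W (?E W))" if "connected_in G W" for W
      using num_span_connected[OF G that] card_spanning_trees_induced[OF G, of W] that
      by (simp add: connected_in_def)
    have low: "num_span G V1 * num_span G V2 \<le> num_span G V"
      unfolding span[OF c1] span[OF c2] span[OF cV] unfolding assms(7)
      using E2 uv finE disj by (intro card_tree_edges_join_ge[of _ u v]) fastforce+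
    have "num_span G V \<le> card (V1 \<union> V2) ^ (card ?B - 1) * (num_span G V1 * num_span G V2)"
      unfolding span[OF c1] span[OF c2] span[OF cV] EV unfolding assms(7)
      using E2 finE False by (intro card_tree_edges_crossing[OF fin disj _ _ conn]) auto
    moreover have "card (V1 \<union> V2) = card V1 + card V2"
      using fin disj by (rule card_Un_disjoint)
    ultimately have up: "num_span G V \<le> (card V1 + card V2) ^ (num_between G V1 V2 - 1) *
        (num_span G V1 * num_span G V2)"
      by (simp add: num_between_def)
    have "real (num_span G V) \<le> real ((card V1 + card V2) ^ (num_between G V1 V2 - 1)) *
        (real (num_span G V1) * real (num_span G V2))"
      using of_nat_mono[OF up, where 'a = real] by simp
    moreover have "real ((card V1 + card V2) ^ (num_between G V1 V2 - 1)) \<le>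
        exp (real (num_between G V1 V2) * (ln (real (card V1)) + ln (real (card V2)) + ln 2))"
      (is "?c \<le> ?e")
    proof (rule add_power_le_exp)
      show "card V1 > 0" "card V2 > 0" using fin ne by (simp_all add: card_gt_0_iff)
      show "num_between G V1 V2 > 0"
        unfolding num_between_def using False finE by (simp add: card_gt_0_iff)
    qed
    then have "?c * (real (num_span G V1) * real (num_span G V2)) \<le>
        ?e * (real (num_span G V1) * real (num_span G V2))"
      by (rule mult_right_mono) simp
    ultimately show ?thesis using low by (simp add: mult.commute)
  qed
qed

end
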